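(* Assume A1, A2 and A3 (stated in the context), and let $x^\star\in B_{\rho/2}(x_0)$ be a solution of $F(x^\star)=y$ as provided by A3. Let $\delta>0$, $y^\delta\in Y$ with $\|y^\delta-y\|\le\delta$, $\tau>\frac{1+\eta}{1-\eta}$, and let $\theta_k\in(0,2)$. Then the noisy-data relaxed projection Landweber iterates $x_k^\delta$ (see context), together with the discrepancy stopping index $k_*^\delta$, are well defined, and $$x_k^\delta\in B_{\rho/2}(x^\star)\subset B_\rho(x_0)\qquad\text{for all }k\le k_*^\delta.$$ Moreover, if there is an interval $[a,b]\subset(0,2)$ such that $\theta_k\in[a,b]$ for all $k\le k_*^\delta$, then the stopping index $k_*^\delta$ is finite.
   Context: $X,Y$ are real Hilbert spaces, $F:D(F)\subset X\to Y$ is a (nonlinear) operator, $y\in Y$ is the exact data, and $F_\delta(x):=F(x)-y^\delta$. $B_r(z)$ denotes the open ball of radius $r$ centered at $z$ in $X$. A1: $F$ is continuous on $D(F)$, which has nonempty interior; there are constants $C,\rho>0$ and $x_0\in D(F)$ with $B_\rho(x_0)\subset D(F)$ such that the Gateaux derivative $F'(x)$ (a bounded linear operator $X\to Y$) exists for $x\in B_\rho(x_0)$ and $\|F'(x)\|\le C$ there. A2 (tangential cone condition): there is a constant $\eta\in[0,1)$ such that $\|F(\bar x)-F(x)-F'(x)(\bar x-x)\|\le\eta\|F(\bar x)-F(x)\|$ for all $x,\bar x\in B_\rho(x_0)$. A3: there is $x^\star\in B_{\rho/2}(x_0)$ with $F(x^\star)=y$. Noisy-data relaxed projection Landweber iteration: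 $x_0^\delta:=x_0$ and, as long as $\|F_\delta(x_k^\delta)\|>\tau\delta$, $$x_{k+1}^\delta:=x_k^\delta-\theta_k\frac{p_\delta(\|F_\delta(x_k^\delta)\|)}{\|F'(x_k^\delta)^*F_\delta(x_k^\delta)\|^2}F'(x_k^\delta)^*F_\delta(x_k^\delta),\qquad p_\delta(t):=t\big((1-\eta)t-(1+\eta)\delta\big).$$ Discrepancy principle: $k_*^\delta:=\max\{k\in\mathbb{N}:\ \|F_\delta(x_j^\delta)\|>\tau\delta,\ j=0,1,\dots,k-1\}$, where $k=0$ always belongs to this set and $k_*^\delta:=\infty$ if the set is unbounded (in which case "$k\le k_*^\delta$" means all $k\in\mathbb{N}$). Well-definedness means that each iterate $x_k^\delta$, $k\le k_*^\delta$, lies in $B_\rho(x_0)$ and that $F'(x_k^\delta)^*F_\delta(x_k^\delta)\ne0$ for every $k<k_*^\delta$. *)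

theory Defs
  imports "HOL-Analysis.Analysis" "HOL-Library.Extended_Nat"
begin

text \<open>
  A real Hilbert space is a type of sort \<open>{real_inner, complete_space}\<close>. The operator with
  domain \<open>D\<close> is given by a total function \<open>F\<close> whose values outside \<open>D\<close> are arbitrary.
\<close>

text \<open>
  Only interior points of the domain of \<open>F\<close> are meant as \<open>x\<close>: there \<open>x + t *\<^sub>R h\<close> lies in the
  domain for all small \<open>t\<close>, so the values of \<open>F\<close> outside its domain are irrelevant.
\<close>
definition has_gateaux_derivative ::
    "('a::real_normed_vector \<Rightarrow> 'b::real_normed_vector) \<Rightarrow> ('a \<Rightarrow>\<^sub>L 'b) \<Rightarrow> 'a \<Rightarrow> bool" where
  "has_gateaux_derivative F L x \<longleftrightarrow>
     (\<forall>h. ((\<lambda>t::real. (F (x + t *\<^sub>R h) - F x) /\<^sub>R t) \<longlongrightarrow> blinfun_apply L h) (at 0))"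

definition tangential_cone ::
    "real \<Rightarrow> 'a set \<Rightarrow> ('a::real_normed_vector \<Rightarrow> 'b::real_normed_vector) \<Rightarrow> ('a \<Rightarrow> 'a \<Rightarrow>\<^sub>L 'b) \<Rightarrow> bool" where
  "tangential_cone \<eta> B F F' \<longleftrightarrow>
     (\<forall>x\<in>B. \<forall>z\<in>B. norm (F z - F x - blinfun_apply (F' x) (z - x)) \<le> \<eta> * norm (F z - F x))"

definition residual :: "('a \<Rightarrow> 'b::real_inner) \<Rightarrow> 'b \<Rightarrow> 'a \<Rightarrow> 'b" where
  "residual F y\<delta> x = F x - y\<delta>"

text \<open>For bounded linear maps on a Hilbert space, \<open>adjoint\<close> is the usual adjoint (Riesz).\<close>
definition landweber_direction ::
    "('a::real_inner \<Rightarrow> 'b::real_inner) \<Rightarrow> ('a \<Rightarrow> 'a \<Rightarrow>\<^sub>L 'b) \<Rightarrow> 'b \<Rightarrow> 'a \<Rightarrow> 'a" where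
  "landweber_direction F F' y\<delta> x = adjoint (blinfun_apply (F' x)) (residual F y\<delta> x)"

definition p_fun :: "real \<Rightarrow> real \<Rightarrow> real \<Rightarrow> real" where
  "p_fun \<eta> \<delta> t = t * ((1 - \<eta>) * t - (1 + \<eta>) * \<delta>)"

text \<open>
  The recursion is total (with \<open>t / 0 = 0\<close>): only the values at indices up to the stopping index
  are meaningful, and that no division by zero or evaluation outside the domain occurs
  in computing them is a separate claim (well-definedness).
\<close>
primrec rpl_iter ::
    "('a::real_inner \<Rightarrow> 'b::real_inner) \<Rightarrow> ('a \<Rightarrow> 'a \<Rightarrow>\<^sub>L 'b) \<Rightarrow> real \<Rightarrow> real \<Rightarrow> 'b \<Rightarrow> (nat \<Rightarrow> real)
       \<Rightarrow> 'a \<Rightarrow> nat \<Rightarrow> 'a" where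
  "rpl_iter F F' \<eta> \<delta> y\<delta> \<theta> x0 0 = x0"
| "rpl_iter F F' \<eta> \<delta> y\<delta> \<theta> x0 (Suc k) =
     (let x = rpl_iter F F' \<eta> \<delta> y\<delta> \<theta> x0 k; g = landweber_direction F F' y\<delta> x
      in x - (\<theta> k * (p_fun \<eta> \<delta> (norm (residual F y\<delta> x)) / (norm g)\<^sup>2)) *\<^sub>R g)"

definition stopping_index ::
    "('a \<Rightarrow> 'b::real_inner) \<Rightarrow> 'b \<Rightarrow> real \<Rightarrow> real \<Rightarrow> (nat \<Rightarrow> 'a) \<Rightarrow> enat" where
  "stopping_index F y\<delta> \<tau> \<delta> x =
     (let K = {k. \<forall>j<k. norm (residual F y\<delta> (x j)) > \<tau> * \<delta>}
      in if finite K then enat (Max K) else \<infinity>)"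

end

theory Submission
  imports Defs
begin

text \<open>
  For a residual \<open>r = F x - y\<delta>\<close> of norm \<open>t\<close> and \<open>g = F'(x)\<^sup>* r\<close>, the tangential cone condition gives
  \<open>g \<bullet> (x - x\<^sup>\<star>) = r \<bullet> F'(x) (x - x\<^sup>\<star>) \<ge> p\<^sub>\<delta>(t)\<close>, so each step is a relaxed projection onto a
  half-space containing \<open>x\<^sup>\<star>\<close> and the squared error drops by at least
  \<open>\<theta> (2 - \<theta>) (p\<^sub>\<delta>(t) / \<parallel>g\<parallel>)\<^sup>2\<close>. As \<open>\<parallel>g\<parallel> \<le> C t\<close>, the discrepancy principle bounds
  \<open>p\<^sub>\<delta>(t) / \<parallel>g\<parallel>\<close> below by a positive constant before stopping, so for \<open>\<theta>\<close> bounded away from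
  \<open>0\<close> and \<open>2\<close> only finitely many steps are possible.
\<close>

section \<open>Riesz representation and the Hilbert space adjoint\<close>

text \<open>
  The representing vector minimises \<open>u \<mapsto> \<parallel>u\<parallel>\<^sup>2 - 2 f u\<close>; minimising sequences are Cauchy
  by the parallelogram identity.
\<close>
lemma riesz_representation:
  fixes f :: "'a::{real_inner, complete_space} \<Rightarrow> real"
  assumes f: "bounded_linear f"
  shows "\<exists>u. \<forall>h. f h = inner u h"
proof -
  interpret f: bounded_linear f by fact
  define J where "J u = (norm u)\<^sup>2 - 2 * f u" for u
  obtain K where K: "\<And>u. norm (f u) \<le> norm u * K"
    using f.bounded by blast
  \<comment> \<open>Completing the square: \<open>f u \<le> norm u * K\<close> makes
    \<open>J u\<close> at least \<open>(norm u - K)\<^sup>2 - K\<^sup>2\<close>.\<close>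
  have lower: "- K\<^sup>2 \<le> J u" for u
  proof -
    have "f u \<le> norm u * K" using K[of u] by simp
    moreover have "0 \<le> (norm u - K)\<^sup>2" by simp
    ultimately show ?thesis unfolding J_def power2_diff by linarith
  qed
  define m where "m = Inf (range J)"
  have bdd: "bdd_below (range J)" using lower by (rule bdd_belowI2)
  have m_le: "m \<le> J u" for u
    unfolding m_def using bdd by (simp add: cINF_lower)
  have "\<exists>u. J u < m + 1 / real (Suc n)" for n
  proof -
    have "Inf (range J) < m + 1 / real (Suc n)" unfolding m_def by simp
    then show ?thesis using cInf_lessD[of "range J"] by auto
  qed
  then obtain w where w: "\<And>n. J (w n) < m + 1 / real (Suc n)" by metis
  have parallelogram: "(norm (u - v))\<^sup>2 = 2 * (J u + J v - 2 * J ((1/2) *\<^sub>R (u + v)))" for u v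
  proof -
    have "(norm (u - v))\<^sup>2 = 2 * (norm u)\<^sup>2 + 2 * (norm v)\<^sup>2 - (norm (u + v))\<^sup>2"
      unfolding power2_norm_eq_inner by (simp add: inner_simps inner_commute)
    moreover have "J ((1/2) *\<^sub>R (u + v)) = (norm (u + v))\<^sup>2 / 4 - (f u + f v)"
      unfolding J_def by (simp add: f.scaleR f.add power2_eq_square add_divide_distrib)
    ultimately show ?thesis unfolding J_def by simp
  qed
  have "Cauchy w"
  proof (rule CauchyI)
    fix e :: real assume "0 < e"
    \<comment> \<open>Values of \<open>J\<close> below \<open>m + r\<close> at two points and at
      least \<open>m\<close> at their midpoint put the squared distance below \<open>4 * r\<close>,
      so \<open>N\<close> is chosen to make \<open>4 * r < e\<^sup>2\<close>.\<close>
    then obtain N where N: "4 / e\<^sup>2 < real N" using reals_Archimedean2 by blast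
    define r where "r = 1 / real (Suc N)"
    have r: "4 * r < e\<^sup>2"
    proof -
      have "4 < e\<^sup>2 * real N" using N \<open>0 < e\<close> by (simp add: divide_less_eq mult.commute)
      also have "\<dots> \<le> e\<^sup>2 * real (Suc N)" by (intro mult_left_mono) auto
      finally show ?thesis unfolding r_def by (simp add: divide_less_eq)
    qed
    have w_less: "J (w k) < m + r" if "k \<ge> N" for k
    proof -
      have "1 / real (Suc k) \<le> r" using that by (simp add: frac_le r_def)
      then show ?thesis using w[of k] by linarith
    qed
    have "norm (w i - w j) < e" if "i \<ge> N" "j \<ge> N" for i j
    proof -
      have "(norm (w i - w j))\<^sup>2 < e\<^sup>2"
        using parallelogram[of "w i" "w j"] m_le[of "(1/2) *\<^sub>R (w i + w j)"]
          w_less[OF that(1)] w_less[OF that(2)] r by argo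
      then show ?thesis using \<open>0 < e\<close> by (simp add: power2_less_imp_less)
    qed
    then show "\<exists>M. \<forall>i\<ge>M. \<forall>j\<ge>M. norm (w i - w j) < e" by blast
  qed
  then obtain u where u: "w \<longlonglongrightarrow> u"
    using Cauchy_convergent convergent_def by blast
  have "(\<lambda>n. J (w n)) \<longlonglongrightarrow> J u"
    unfolding J_def by (intro tendsto_intros u f.tendsto)
  moreover have "(\<lambda>n. m + 1 / real (Suc n)) \<longlonglongrightarrow> m + 0"
    using LIMSEQ_inverse_real_of_nat by (intro tendsto_intros) (simp add: inverse_eq_divide)
  ultimately have "J u \<le> m + 0"
    by (rule LIMSEQ_le) (intro exI allI impI less_imp_le[OF w])
  then have min: "J u \<le> J v" for v using m_le[of v] by simp
  have "f h = inner u h" for h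
  proof (cases "h = 0")
    case True
    then show ?thesis by (simp add: f.zero)
  next
    case False
    define s where "s = inner u h - f h"
    \<comment> \<open>Along the line through \<open>u\<close> in direction \<open>h\<close>,
      \<open>J\<close> is a quadratic polynomial with slope \<open>2 * s\<close> at
      \<open>u\<close>. This \<open>t\<close> is its minimum point, lower than \<open>J u\<close> by
      \<open>s\<^sup>2 / (norm h)\<^sup>2\<close>, so minimality of \<open>u\<close> forces
      \<open>s = 0\<close>.\<close>
    define t where "t = - s / (norm h)\<^sup>2"
    have "J (u + t *\<^sub>R h) = J u + 2 * t * s + t\<^sup>2 * (norm h)\<^sup>2"
      unfolding J_def s_def f.add f.scaleR power2_norm_eq_inner
      by (simp add: inner_simps inner_commute power2_eq_square algebra_simps)
    also have "2 * t * s + t\<^sup>2 * (norm h)\<^sup>2 = - (s\<^sup>2 / (norm h)\<^sup>2)"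
      using False unfolding t_def by (simp add: power2_eq_square field_simps)
    then have "J u + 2 * t * s + t\<^sup>2 * (norm h)\<^sup>2 = J u - s\<^sup>2 / (norm h)\<^sup>2" by linarith
    finally have "s\<^sup>2 / (norm h)\<^sup>2 \<le> 0" using min[of "u + t *\<^sub>R h"] by linarith
    then have "s = 0" using False by (simp add: divide_le_0_iff)
    then show ?thesis unfolding s_def by simp
  qed
  then show ?thesis by blast
qed

text \<open>\<open>adjoint\<close> is defined by choice, so its defining identity holds once some
  map satisfies it. Riesz, applied to \<open>inner (A x) z\<close> as a functional of
  \<open>x\<close> for each \<open>z\<close>, provides such a map.\<close>

lemma inner_adjoint_hilbert:
  fixes A :: "'a::{real_inner, complete_space} \<Rightarrow> 'b::real_inner"
  assumes A: "bounded_linear A"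
  shows "inner x (adjoint A y) = inner (A x) y"
proof -
  have "\<exists>u. \<forall>x. inner (A x) z = inner u x" for z
    by (rule riesz_representation) (rule bounded_linear_compose[OF bounded_linear_inner_left A])
  then obtain B where "\<And>x z. inner (A x) z = inner (B z) x" by metis
  then have "\<forall>x z. inner (A x) z = inner x (B z)" by (simp add: inner_commute)
  then have "\<forall>x z. inner (A x) z = inner x (adjoint A z)"
    unfolding adjoint_def
    by (rule someI[where P = "\<lambda>B. \<forall>x z. inner (A x) z = inner x (B z)"])
  then show ?thesis by simp
qed

text \<open>Test the adjoint identity with the adjoint vector itself, apply Cauchy-Schwarz and
  cancel one factor of its norm.\<close>

lemma norm_adjoint_blinfun_le:
  fixes A :: "'a::{real_inner, complete_space} \<Rightarrow>\<^sub>L 'b::real_inner"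
  shows "norm (adjoint (blinfun_apply A) y) \<le> norm A * norm y"
proof (cases "adjoint (blinfun_apply A) y = 0")
  case True
  then show ?thesis by simp
next
  case False
  let ?g = "adjoint (blinfun_apply A) y"
  have "norm ?g * norm ?g = inner (A ?g) y"
    by (simp add: inner_adjoint_hilbert[OF blinfun.bounded_linear_right, symmetric]
        flip: power2_eq_square power2_norm_eq_inner)
  also have "\<dots> \<le> norm (A ?g) * norm y" by (rule norm_cauchy_schwarz)
  also have "\<dots> \<le> (norm A * norm ?g) * norm y"
    by (intro mult_right_mono norm_blinfun) auto
  finally have "norm ?g * norm ?g \<le> norm ?g * (norm A * norm y)" by (simp add: ac_simps)
  then show ?thesis using False by simp
qed

section \<open>Estimates for a single iteration step\<close>

text \<open>For \<theta> = 1 the step projects \<open>x\<close> onto the half-space of all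
  \<open>v\<close> with \<open>p \<le> inner g (x - v)\<close>, which contains \<open>z\<close>.
  Expanding the square with step size \<open>s\<close> leaves a decrease of at least
  \<open>2 * s * p - s\<^sup>2 * (norm g)\<^sup>2\<close>.\<close>

lemma relaxed_projection_step:
  fixes g x z :: "'a::real_inner"
  assumes p: "0 \<le> p" "p \<le> inner g (x - z)" and g: "g \<noteq> 0" and \<theta>: "0 \<le> \<theta>"
  shows "(norm (x - (\<theta> * (p / (norm g)\<^sup>2)) *\<^sub>R g - z))\<^sup>2
    \<le> (norm (x - z))\<^sup>2 - \<theta> * (2 - \<theta>) * (p / norm g)\<^sup>2"
proof -
  define s where "s = \<theta> * (p / (norm g)\<^sup>2)"
  have "0 \<le> s" using p \<theta> by (simp add: s_def)
  have "(norm (x - s *\<^sub>R g - z))\<^sup>2 = (norm (x - z))\<^sup>2 - 2 * s * inner g (x - z) + s\<^sup>2 * (norm g)\<^sup>2"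
    unfolding power2_norm_eq_inner
    by (simp add: inner_simps inner_commute power2_eq_square algebra_simps)
  also have "\<dots> \<le> (norm (x - z))\<^sup>2 - 2 * s * p + s\<^sup>2 * (norm g)\<^sup>2"
    using mult_left_mono[OF p(2) \<open>0 \<le> s\<close>] by linarith
  also have "2 * s * p - s\<^sup>2 * (norm g)\<^sup>2 = \<theta> * (2 - \<theta>) * (p / norm g)\<^sup>2"
    using g unfolding s_def by (simp add: power2_eq_square field_simps)
  then have "(norm (x - z))\<^sup>2 - 2 * s * p + s\<^sup>2 * (norm g)\<^sup>2
    = (norm (x - z))\<^sup>2 - \<theta> * (2 - \<theta>) * (p / norm g)\<^sup>2" by linarith
  finally show ?thesis unfolding s_def .
qed

text \<open>This explains the form of \<open>p_fun\<close>. \<open>F' x (x - z)\<close> is the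
  residual \<open>r\<close> plus the linearization error \<open>q\<close> and the data error; paired
  with \<open>r\<close>, these two errors cost at most
  \<open>norm r * (\<eta> * (norm r + \<delta>))\<close> and
  \<open>norm r * \<delta>\<close>.\<close>

lemma tangential_cone_inner_residual_ge:
  fixes F :: "'a::{real_inner, complete_space} \<Rightarrow> 'b::real_inner"
  assumes cone: "tangential_cone \<eta> B F F'" and B: "x \<in> B" "z \<in> B"
    and \<eta>: "0 \<le> \<eta>" and noise: "norm (y\<delta> - F z) \<le> \<delta>"
  shows "p_fun \<eta> \<delta> (norm (residual F y\<delta> x)) \<le> inner (landweber_direction F F' y\<delta> x) (x - z)"
proof -
  define r where "r = residual F y\<delta> x"
  define q where "q = F z - F x - F' x (z - x)"
  have Fzx: "F z - F x = - r - (y\<delta> - F z)"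
    unfolding r_def residual_def by simp
  have "norm (F z - F x) \<le> norm r + \<delta>"
    unfolding Fzx using norm_triangle_ineq4[of "- r" "y\<delta> - F z"] noise by simp
  moreover have "norm q \<le> \<eta> * norm (F z - F x)"
    using cone B unfolding tangential_cone_def q_def by blast
  ultimately have q: "norm q \<le> \<eta> * (norm r + \<delta>)"
    using \<eta> by (meson mult_left_mono order_trans)
  have "F' x (x - z) = q + r + (y\<delta> - F z)"
    unfolding q_def r_def residual_def by (simp add: blinfun.diff_right)
  then have "inner (landweber_direction F F' y\<delta> x) (x - z) = inner r (q + r + (y\<delta> - F z))"
    unfolding landweber_direction_def r_def[symmetric]
    by (simp add: inner_commute inner_adjoint_hilbert[OF blinfun.bounded_linear_right])
  also have "\<dots> = (norm r)\<^sup>2 - inner r (- q) - inner r (- (y\<delta> - F z))"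
    by (simp add: inner_simps power2_norm_eq_inner)
  also have "\<dots> \<ge> (norm r)\<^sup>2 - norm r * (\<eta> * (norm r + \<delta>)) - norm r * \<delta>"
  proof -
    have "inner r (- q) \<le> norm r * (\<eta> * (norm r + \<delta>))"
      using norm_cauchy_schwarz[of r "- q"] mult_left_mono[OF q, of "norm r"] by simp
    moreover have "inner r (- (y\<delta> - F z)) \<le> norm r * \<delta>"
      using norm_cauchy_schwarz[of r "- (y\<delta> - F z)"] mult_left_mono[OF noise, of "norm r"]
      by (simp add: norm_minus_commute)
    ultimately show ?thesis by linarith
  qed
  also have "(norm r)\<^sup>2 - norm r * (\<eta> * (norm r + \<delta>)) - norm r * \<delta> = p_fun \<eta> \<delta> (norm r)"
    unfolding p_fun_def by (simp add: power2_eq_square algebra_simps)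
  finally show ?thesis unfolding r_def .
qed

text \<open>Some element of \<open>K\<close> exceeds \<open>k\<close>: \<open>Max K\<close> if
  \<open>K\<close> is finite, and otherwise one exists because \<open>K\<close> is unbounded.
  \<open>0 \<in> K\<close> ensures that the maximum is attained.\<close>

lemma norm_residual_before_stopping:
  assumes "enat k < stopping_index F y\<delta> \<tau> \<delta> x"
  shows "\<tau> * \<delta> < norm (residual F y\<delta> (x k))"
proof -
  define K where "K = {k. \<forall>j<k. norm (residual F y\<delta> (x j)) > \<tau> * \<delta>}"
  have "0 \<in> K" unfolding K_def by simp
  have "\<exists>n\<in>K. k < n"
  proof (cases "finite K")
    case True
    then have "Max K \<in> K" using \<open>0 \<in> K\<close> Max_in by blast
    moreover have "k < Max K"
      using assms True unfolding stopping_index_def K_def[symmetric] Let_def by simp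
    ultimately show ?thesis by blast
  next
    case False
    then show ?thesis using infinite_nat_iff_unbounded by blast
  qed
  then show ?thesis unfolding K_def by blast
qed

section \<open>Monotone error decrease and finiteness of the stopping index\<close>

theorem theorem4p3:
  fixes D :: "'a::{real_inner, complete_space} set"
    and F :: "'a \<Rightarrow> 'b::{real_inner, complete_space}"
    and F' :: "'a \<Rightarrow> 'a \<Rightarrow>\<^sub>L 'b"
    and x0 xstar :: 'a
    and y y\<delta> :: 'b
    and C \<rho> \<eta> \<delta> \<tau> :: real
    and \<theta> :: "nat \<Rightarrow> real"
  defines "x \<equiv> rpl_iter F F' \<eta> \<delta> y\<delta> \<theta> x0"
  defines "kstar \<equiv> stopping_index F y\<delta> \<tau> \<delta> x"
  assumes A1_continuous: "continuous_on D F"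
    and A1_interior: "interior D \<noteq> {}"
    and A1_constants: "C > 0" "\<rho> > 0"
    and A1_ball: "x0 \<in> D" "ball x0 \<rho> \<subseteq> D"
    and A1_derivative: "\<forall>z\<in>ball x0 \<rho>. has_gateaux_derivative F (F' z) z \<and> norm (F' z) \<le> C"
    and A2_eta: "0 \<le> \<eta>" "\<eta> < 1"
    and A2_cone: "tangential_cone \<eta> (ball x0 \<rho>) F F'"
    and A3: "xstar \<in> ball x0 (\<rho> / 2)" "F xstar = y"
    and noise: "\<delta> > 0" "norm (y\<delta> - y) \<le> \<delta>"
    and tau: "\<tau> > (1 + \<eta>) / (1 - \<eta>)"
    and theta: "\<forall>k. \<theta> k \<in> {0<..<2}"
  shows "(\<forall>k. enat k \<le> kstar \<longrightarrow> x k \<in> ball x0 \<rho>) \<and>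
    (\<forall>k. enat k < kstar \<longrightarrow> landweber_direction F F' y\<delta> (x k) \<noteq> 0) \<and>
    ball xstar (\<rho> / 2) \<subseteq> ball x0 \<rho> \<and>
    (\<forall>k. enat k \<le> kstar \<longrightarrow> x k \<in> ball xstar (\<rho> / 2)) \<and>
    ((\<exists>a b. {a..b} \<subseteq> {0<..<2} \<and> (\<forall>k. enat k \<le> kstar \<longrightarrow> \<theta> k \<in> {a..b})) \<longrightarrow> kstar \<noteq> \<infinity>)"
proof -
  define g where "g k = landweber_direction F F' y\<delta> (x k)" for k
  define t where "t k = norm (residual F y\<delta> (x k))" for k
  \<comment> \<open>Before stopping, the residual norm exceeds \<open>\<tau> * \<delta>\<close>, so
    \<open>c\<close> bounds the second factor of \<open>p_fun\<close> from below; the condition on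
    \<tau> amounts to \<open>0 < c\<close>.\<close>
  define c where "c = ((1 - \<eta>) * \<tau> - (1 + \<eta>)) * \<delta>"
  have "0 < c"
    using tau noise A2_eta unfolding c_def by (simp add: divide_less_eq mult.commute)
  have "0 < (1 + \<eta>) / (1 - \<eta>)"
    using A2_eta by simp
  then have "0 < \<tau>"
    using tau by linarith
  have subset: "ball xstar (\<rho> / 2) \<subseteq> ball x0 \<rho>"
  proof
    fix z assume "z \<in> ball xstar (\<rho> / 2)"
    then show "z \<in> ball x0 \<rho>"
      using A3 dist_triangle[of x0 z xstar] by simp
  qed
  have xstar: "xstar \<in> ball x0 \<rho>"
    using A3 A1_constants by simp
  have Suc_eq: "x (Suc k) = x k - (\<theta> k * (p_fun \<eta> \<delta> (t k) / (norm (g k))\<^sup>2)) *\<^sub>R g k" for k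
    unfolding x_def g_def t_def by (simp add: Let_def)
  have t_pos: "0 < t k" and p_ge: "t k * c \<le> p_fun \<eta> \<delta> (t k)" if "enat k < kstar" for k
  proof -
    have *: "\<tau> * \<delta> < t k"
      using norm_residual_before_stopping that unfolding kstar_def t_def by blast
    then show t0: "0 < t k" using mult_pos_pos[OF \<open>0 < \<tau>\<close> noise(1)] by linarith
    have "(1 - \<eta>) * (\<tau> * \<delta>) \<le> (1 - \<eta>) * t k" using * A2_eta by (intro mult_left_mono) auto
    then have "c \<le> (1 - \<eta>) * t k - (1 + \<eta>) * \<delta>" unfolding c_def by (simp add: algebra_simps)
    then show "t k * c \<le> p_fun \<eta> \<delta> (t k)" unfolding p_fun_def using t0 by simp
  qed
  have inner_ge: "p_fun \<eta> \<delta> (t k) \<le> inner (g k) (x k - xstar)" if "x k \<in> ball x0 \<rho>" for k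
    unfolding g_def t_def
    using tangential_cone_inner_residual_ge[OF A2_cone that xstar A2_eta(1)] noise A3 by simp
  \<comment> \<open>A zero direction would make the inner product in \<open>inner_ge\<close> vanish,
    against the positive lower bound for \<open>p_fun\<close>.\<close>
  have g_nz: "g k \<noteq> 0" if "enat k < kstar" "x k \<in> ball x0 \<rho>" for k
    using inner_ge[OF that(2)] p_ge[OF that(1)] mult_pos_pos[OF t_pos[OF that(1)] \<open>0 < c\<close>] by auto
  \<comment> \<open>In the quotient of \<open>p_fun\<close> by \<open>norm (g k)\<close>, the
    numerator is at least \<open>t k * c\<close> and the denominator at most \<open>C * t k\<close>;
    cancelling \<open>t k\<close> leaves the bound \<open>c / C\<close>, uniform in
    \<open>k\<close>.\<close>
  have decrease: "(norm (x (Suc k) - xstar))\<^sup>2 \<le> (norm (x k - xstar))\<^sup>2 - \<theta> k * (2 - \<theta> k) * (c / C)\<^sup>2"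
    if k: "enat k < kstar" "x k \<in> ball x0 \<rho>" for k
  proof -
    have p_pos: "0 < p_fun \<eta> \<delta> (t k)"
      using p_ge[OF k(1)] mult_pos_pos[OF t_pos[OF k(1)] \<open>0 < c\<close>] by linarith
    have \<theta>: "0 < \<theta> k" "\<theta> k < 2" using theta by auto
    have "norm (g k) \<le> norm (F' (x k)) * t k"
      unfolding g_def t_def landweber_direction_def by (rule norm_adjoint_blinfun_le)
    also have "\<dots> \<le> C * t k"
      using A1_derivative k(2) t_pos[OF k(1)] by (intro mult_right_mono) auto
    finally have "norm (g k) \<le> C * t k" .
    then have "t k * c / (C * t k) \<le> p_fun \<eta> \<delta> (t k) / norm (g k)"
      using p_ge[OF k(1)] p_pos g_nz[OF k] by (intro frac_le) auto
    then have "c / C \<le> p_fun \<eta> \<delta> (t k) / norm (g k)"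
      using t_pos[OF k(1)] by simp
    then have "(c / C)\<^sup>2 \<le> (p_fun \<eta> \<delta> (t k) / norm (g k))\<^sup>2"
      using \<open>0 < c\<close> A1_constants by (intro power_mono) auto
    then have "\<theta> k * (2 - \<theta> k) * (c / C)\<^sup>2 \<le> \<theta> k * (2 - \<theta> k) * (p_fun \<eta> \<delta> (t k) / norm (g k))\<^sup>2"
      using \<theta> by (intro mult_left_mono) auto
    moreover have "(norm (x (Suc k) - xstar))\<^sup>2
      \<le> (norm (x k - xstar))\<^sup>2 - \<theta> k * (2 - \<theta> k) * (p_fun \<eta> \<delta> (t k) / norm (g k))\<^sup>2"
      unfolding Suc_eq using p_pos inner_ge[OF k(2)] g_nz[OF k] \<theta>
      by (intro relaxed_projection_step) auto
    ultimately show ?thesis by linarith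
  qed
  \<comment> \<open>\<open>decrease\<close> requires the current iterate to lie in the ball around
    \<open>x0\<close>. The induction hypothesis and \<open>subset\<close> supply this, and the error
    then does not grow.\<close>
  have in_ball: "x k \<in> ball xstar (\<rho> / 2)" if "enat k \<le> kstar" for k
    using that
  proof (induction k)
    case 0
    then show ?case using A3 by (simp add: x_def dist_commute)
  next
    case (Suc k)
    then have k: "enat k < kstar" by (simp add: Suc_ile_eq)
    then have IH: "x k \<in> ball xstar (\<rho> / 2)" using Suc.IH by simp
    have "0 \<le> \<theta> k * (2 - \<theta> k) * (c / C)\<^sup>2" using theta by (simp add: less_imp_le)
    then have "(norm (x (Suc k) - xstar))\<^sup>2 \<le> (norm (x k - xstar))\<^sup>2"
      using decrease[OF k subsetD[OF subset IH]] by linarith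
    then have "norm (x (Suc k) - xstar) \<le> norm (x k - xstar)" by simp
    then show ?case using IH by (simp add: dist_norm norm_minus_commute)
  qed
  have finite: "kstar \<noteq> \<infinity>" if ab: "{a..b} \<subseteq> {0<..<2}" "\<forall>k. enat k \<le> kstar \<longrightarrow> \<theta> k \<in> {a..b}" for a b
  proof
    assume inf: "kstar = \<infinity>"
    then have \<theta>: "a \<le> \<theta> k" "\<theta> k \<le> b" for k using ab(2) by auto
    \<comment> \<open>An empty interval would satisfy the inclusion for any endpoints. As it
      contains \<open>\<theta> 0\<close>, both endpoints belong to it and hence lie strictly between
      0 and 2.\<close>
    have "a \<le> b" using \<theta>[of 0] by linarith
    then have "0 < a" "b < 2" using ab(1) by auto
    \<comment> \<open>Bounding \<theta> below by \<open>a\<close> and 2 - \<theta> below by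
      \<open>2 - b\<close> turns \<open>decrease\<close> into a fixed loss \<open>d\<close> per
      step.\<close>
    define d where "d = a * (2 - b) * (c / C)\<^sup>2"
    have "0 < d" unfolding d_def using \<open>0 < a\<close> \<open>b < 2\<close> \<open>0 < c\<close> A1_constants by simp
    have step: "(norm (x (Suc k) - xstar))\<^sup>2 \<le> (norm (x k - xstar))\<^sup>2 - d" for k
    proof -
      have "a * (2 - b) \<le> \<theta> k * (2 - \<theta> k)"
        using \<theta>[of k] \<open>0 < a\<close> \<open>b < 2\<close> by (intro mult_mono) auto
      then have "d \<le> \<theta> k * (2 - \<theta> k) * (c / C)\<^sup>2" unfolding d_def by (rule mult_right_mono) simp
      moreover have "x k \<in> ball x0 \<rho>" using in_ball[of k] subset inf by auto
      then have "(norm (x (Suc k) - xstar))\<^sup>2 \<le> (norm (x k - xstar))\<^sup>2 - \<theta> k * (2 - \<theta> k) * (c / C)\<^sup>2"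
        using inf by (intro decrease) auto
      ultimately show ?thesis by linarith
    qed
    have sum: "(norm (x k - xstar))\<^sup>2 \<le> (norm (x 0 - xstar))\<^sup>2 - real k * d" for k
    proof (induction k)
      case (Suc k)
      then show ?case using step[of k] by (simp add: algebra_simps)
    qed simp
    \<comment> \<open>After \<open>n\<close> steps the accumulated loss exceeds the initial squared
      error, which would leave a negative square.\<close>
    obtain n where "(norm (x 0 - xstar))\<^sup>2 < real n * d"
      using reals_Archimedean3[OF \<open>0 < d\<close>] by blast
    then have "(norm (x n - xstar))\<^sup>2 < 0" using sum[of n] by linarith
    then show False by simp
  qed
  show ?thesis
  proof (intro conjI allI impI)
    show "x k \<in> ball xstar (\<rho> / 2)" if "enat k \<le> kstar" for k
      using in_ball that .
    show "x k \<in> ball x0 \<rho>" if "enat k \<le> kstar" for k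
      using subset in_ball[OF that] by (rule subsetD)
    show "landweber_direction F F' y\<delta> (x k) \<noteq> 0" if "enat k < kstar" for k
      using g_nz[OF that subsetD[OF subset in_ball[OF less_imp_le[OF that]]]] unfolding g_def .
    show "ball xstar (\<rho> / 2) \<subseteq> ball x0 \<rho>" by (fact subset)
    show "kstar \<noteq> \<infinity>" if "\<exists>a b. {a..b} \<subseteq> {0<..<2} \<and> (\<forall>k. enat k \<le> kstar \<longrightarrow> \<theta> k \<in> {a..b})"
      using that finite by (elim exE conjE)
  qed
qed

end
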